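(* If $F : ([0,1]^{<\omega})^m \to [0,1]$ is an aggregation function (where $m \in \mathbb{N}^+$), then the following are equivalent: (i) $F$ is ct-continuous with respect to every choice of parameters $c_{i,j}, \alpha_{i,j} \in [0,1]$, $i = 1, \ldots, m$, $j = 1, \ldots, k_i$ (for all $k_1, \ldots, k_m \in \mathbb{N}^+$). (ii) $F$ is up-continuous with respect to every choice of parameters $c_{i,j}, \alpha_{i,j} \in [0,1]$, $i = 1, \ldots, m$, $j = 1, \ldots, k_i$ (for all $k_1, \ldots, k_m \in \mathbb{N}^+$).
   Context: $\mathbb{N}$ and $\mathbb{N}^+$ are the sets of nonnegative, respectively positive, integers. $[0,1]^{<\omega} = \bigcup_{n \ge 1} [0,1]^n$; $|\bar{p}|$ is the length of $\bar{p}$ and $\mathrm{rng}(\bar{p})$ its set of entries. An ($m$-ary) aggregation function is a function $F : ([0,1]^{<\omega})^m \to [0,1]$ whose value does not change when the entries within each argument $\bar{p}_i$ are reordered. **Convergence testing sequences.** A sequence $\bar{p}_n \in [0,1]^{<\omega}$, $n \in \mathbb{N}$, with $i$th entry of $\bar{p}_n$ denoted $p_{n,i}$, is convergence testing for parameters $c_1, \ldots, c_k \in [0,1]$ and $\alpha_1, \ldots, \alpha_k \in [0,1]$ if: (1) $|\bar{p}_n| < |\bar{p}_{n+1}|$ for all $n \in \mathbb{N}$; (2) for every disjoint family of intervals $I_1, \ldots, I_k \subseteq [0,1]$, open in the induced topology on $[0,1]$, such that $c_j \in I_j$ for each $j$, there is $N \in \mathbb{N}$ such that $\mathrm{rng}(\bar{p}_n)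 \subseteq \bigcup_{j=1}^k I_j$ for all $n \ge N$, and for every $j \in \{1, \ldots, k\}$, $\lim_{n\to\infty} |\{i : p_{n,i} \in I_j\}| / |\bar{p}_n| = \alpha_j$. A sequence of $m$-tuples $(\bar{p}_{1,n}, \ldots, \bar{p}_{m,n}) \in ([0,1]^{<\omega})^m$, $n \in \mathbb{N}$, is convergence testing for parameters $c_{i,j}, \alpha_{i,j} \in [0,1]$ ($i = 1, \ldots, m$, $j = 1, \ldots, k_i$) if for each fixed $i$ the sequence $\bar{p}_{i,n}$, $n \in \mathbb{N}$, is convergence testing for $c_{i,1}, \ldots, c_{i,k_i}$ and $\alpha_{i,1}, \ldots, \alpha_{i,k_i}$. **ct-continuity.** $F$ is ct-continuous with respect to parameters $c_{i,j}, \alpha_{i,j} \in [0,1]$ ($i = 1, \ldots, m$, $j = 1, \ldots, k_i$) if for all sequences of $m$-tuples $(\bar{p}_{1,n}, \ldots, \bar{p}_{m,n})$ and $(\bar{q}_{1,n}, \ldots, \bar{q}_{m,n})$, $n \in \mathbb{N}$, that are both convergence testing for these parameters, $\lim_{n\to\infty} |F(\bar{p}_{1,n}, \ldots, \bar{p}_{m,n}) - F(\bar{q}_{1,n}, \ldots, \bar{q}_{m,n})| = 0$. **Functional representations and pseudometrics.** For $\bar{p} = (p_1, \ldots, p_n)$ let $\mathfrak{f}_{\bar{p}} : [0,1] \to [0,1]$ be given by $\mathfrak{f}_{\bar{p}}(a) = p_{i+1}$ for $a \in [i/n, (i+1)/n)$, $i = 0, \ldots, n-1$, and $\mathfrak{f}_{\bar{p}}(1)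 = p_n$. Let $\mathfrak{g}_{\bar{p}} = \mathfrak{f}_{\bar{p}'}$, where $\bar{p}'$ is the reordering of $\bar{p}$ in nondecreasing order. For $\bar{p}, \bar{q} \in [0,1]^{<\omega}$ let $\mu_1^u(\bar{p}, \bar{q}) = \int_{[0,1]} |\mathfrak{g}_{\bar{p}}(x) - \mathfrak{g}_{\bar{q}}(x)|\,dx$ and $\mu_\infty^o(\bar{p}, \bar{q}) = \sup_{a \in [0,1]} |\mathfrak{f}_{\bar{p}}(a) - \mathfrak{f}_{\bar{q}}(a)|$. On $m$-tuples, $\mu_1^u((\bar{p}_1, \ldots, \bar{p}_m), (\bar{q}_1, \ldots, \bar{q}_m)) = \max_i \mu_1^u(\bar{p}_i, \bar{q}_i)$. **Asymptotic uniform continuity.** $F$ is asymptotically uniformly continuous on $X \subseteq ([0,1]^{<\omega})^m$ if for every $\varepsilon > 0$ there are $n$ and $\delta > 0$ such that if $(\bar{p}_1, \ldots, \bar{p}_m), (\bar{q}_1, \ldots, \bar{q}_m) \in X$, $|\bar{p}_i|, |\bar{q}_i| \ge n$ for all $i$, and $\mu_1^u((\bar{p}_1, \ldots, \bar{p}_m), (\bar{q}_1, \ldots, \bar{q}_m)) < \delta$, then $|F(\bar{p}_1, \ldots, \bar{p}_m) - F(\bar{q}_1, \ldots, \bar{q}_m)| < \varepsilon$. **up-continuity.** $F$ is up-continuous with respect to parameters $c_{i,j}, \alpha_{i,j} \in [0,1]$ ($i = 1, \ldots, m$, $j = 1, \ldots, k_i$) if both of the following hold. (1) For all sufficiently small $\delta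 > 0$, $F$ is asymptotically uniformly continuous on $X_1 \times \cdots \times X_m$, where $X_i$ is the set of all $\bar{p} \in [0,1]^{<\omega}$ such that $\mathrm{rng}(\bar{p}) \subseteq \{c_{i,1}, \ldots, c_{i,k_i}\}$ and, for each $j = 1, \ldots, k_i$, the number of coordinates of $\bar{p}$ equal to $c_{i,j}$ is between $(\alpha_{i,j} - \delta)|\bar{p}|$ and $(\alpha_{i,j} + \delta)|\bar{p}|$. (2) For all $\varepsilon > 0$ there are $\delta > 0$ and $n_0$ such that if, for $i = 1, \ldots, m$, $\bar{p}_i, \bar{q}_i \in [0,1]^{<\omega}$ satisfy (a) $|\bar{p}_i| = |\bar{q}_i| > n_0$, (b) $\mu_\infty^o(\bar{p}_i, \bar{q}_i) < \delta$, (c) $\mathrm{rng}(\bar{p}_i) \subseteq \{c_{i,1}, \ldots, c_{i,k_i}\}$, and (d) for each $j = 1, \ldots, k_i$ the number of coordinates of $\bar{p}_i$ equal to $c_{i,j}$ is between $(\alpha_{i,j} - \delta)|\bar{p}_i|$ and $(\alpha_{i,j} + \delta)|\bar{p}_i|$, then $|F(\bar{p}_1, \ldots, \bar{p}_m) - F(\bar{q}_1, \ldots, \bar{q}_m)| < \varepsilon$.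
   Formalization: In (i), for each i the parameters c_{i,1},…,c_{i,k_i} are required to be pairwise distinct; with repetitions no disjoint intervals exist, every sequence of increasing length is convergence testing, and the equivalence fails, e.g. for the arithmetic mean. *)

theory Defs
  imports "HOL-Analysis.Analysis"
begin

text \<open>
  Nonempty finite sequences over \<open>[0,1]\<close> are lists. An \<open>m\<close>-tuple of such sequences is a function
  on a finite index type \<open>'m\<close>, so \<open>m = CARD('m)\<close>, which is an arbitrary positive number.
  Functions on tuples are constrained, and quantified over, only on \<^term>\<open>unit_tuples\<close>.
\<close>

definition unit_seqs :: "real list set" where
  "unit_seqs = {p. p \<noteq> [] \<and> set p \<subseteq> {0..1}}"

definition unit_tuples :: "('m \<Rightarrow> real list) set" where
  "unit_tuples = {p. \<forall>i. p i \<in> unit_seqs}"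

definition aggregation_function :: "(('m::finite \<Rightarrow> real list) \<Rightarrow> real) \<Rightarrow> bool" where
  "aggregation_function F \<longleftrightarrow>
     (\<forall>p\<in>unit_tuples. F p \<in> {0..1}) \<and>
     (\<forall>p\<in>unit_tuples. \<forall>q\<in>unit_tuples. (\<forall>i. mset (p i) = mset (q i)) \<longrightarrow> F p = F q)"

text \<open>
  If \<open>c\<close> is not injective on \<open>{1..k}\<close>, there is no disjoint family \<open>I\<close> as below and only the
  condition on the lengths remains, so this notion is meant for pairwise distinct \<open>c 1, \<dots>, c k\<close>.
\<close>

definition convergence_testing ::
    "nat \<Rightarrow> (nat \<Rightarrow> real) \<Rightarrow> (nat \<Rightarrow> real) \<Rightarrow> (nat \<Rightarrow> real list) \<Rightarrow> bool" where
  "convergence_testing k c \<alpha> p \<longleftrightarrow>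
     (\<forall>n. p n \<in> unit_seqs) \<and>
     (\<forall>n. length (p n) < length (p (Suc n))) \<and>
     (\<forall>I. disjoint_family_on I {1..k} \<and>
          (\<forall>j\<in>{1..k}. is_interval (I j) \<and> openin (top_of_set {0..1}) (I j) \<and> c j \<in> I j) \<longrightarrow>
          (\<exists>N. \<forall>n\<ge>N. set (p n) \<subseteq> (\<Union>j\<in>{1..k}. I j)) \<and>
          (\<forall>j\<in>{1..k}.
             (\<lambda>n. real (card {i. i < length (p n) \<and> p n ! i \<in> I j}) / real (length (p n)))
               \<longlonglongrightarrow> \<alpha> j))"

definition convergence_testing_tuple ::
    "('m \<Rightarrow> nat) \<Rightarrow> ('m \<Rightarrow> nat \<Rightarrow> real) \<Rightarrow> ('m \<Rightarrow> nat \<Rightarrow> real) \<Rightarrow> (nat \<Rightarrow> 'm \<Rightarrow> real list) \<Rightarrow> bool" where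
  "convergence_testing_tuple k c \<alpha> p \<longleftrightarrow>
     (\<forall>i. convergence_testing (k i) (c i) (\<alpha> i) (\<lambda>n. p n i))"

definition ct_continuous ::
    "(('m::finite \<Rightarrow> real list) \<Rightarrow> real) \<Rightarrow> ('m \<Rightarrow> nat) \<Rightarrow> ('m \<Rightarrow> nat \<Rightarrow> real) \<Rightarrow> ('m \<Rightarrow> nat \<Rightarrow> real) \<Rightarrow> bool" where
  "ct_continuous F k c \<alpha> \<longleftrightarrow>
     (\<forall>p q. convergence_testing_tuple k c \<alpha> p \<and> convergence_testing_tuple k c \<alpha> q \<longrightarrow>
        (\<lambda>n. \<bar>F (p n) - F (q n)\<bar>) \<longlonglongrightarrow> 0)"

text \<open>For \<open>a \<in> [0,1)\<close>, the \<open>i\<close> with \<open>a \<in> [i/n, (i+1)/n)\<close> is the floor of \<open>a n\<close>.\<close>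

definition fun_rep :: "real list \<Rightarrow> real \<Rightarrow> real" where
  "fun_rep p a = (if a = 1 then last p else p ! nat \<lfloor>a * real (length p)\<rfloor>)"

lemma fun_rep_eq_nth:
  assumes "i < length p" "a \<in> {real i / real (length p)..<real (i + 1) / real (length p)}"
  shows "fun_rep p a = p ! i"
proof -
  have n: "real (length p) > 0" using assms(1) by linarith
  have "real i \<le> a * real (length p)" "a * real (length p) < real i + 1"
    using assms(2) n by (auto simp: field_simps)
  then have "\<lfloor>a * real (length p)\<rfloor> = int i" by (simp add: floor_eq_iff)
  moreover have "a \<noteq> 1"
    using \<open>a * real (length p) < real i + 1\<close> assms(1) by auto
  ultimately show ?thesis by (simp add: fun_rep_def)
qed

definition mon_rep :: "real list \<Rightarrow> real \<Rightarrow> real" where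
  "mon_rep p = fun_rep (sort p)"

definition mu1u :: "real list \<Rightarrow> real list \<Rightarrow> real" where
  "mu1u p q = integral {0..1} (\<lambda>x. \<bar>mon_rep p x - mon_rep q x\<bar>)"

definition muinfo :: "real list \<Rightarrow> real list \<Rightarrow> real" where
  "muinfo p q = (SUP a\<in>{0..1}. \<bar>fun_rep p a - fun_rep q a\<bar>)"

definition mu1u_tuple :: "('m::finite \<Rightarrow> real list) \<Rightarrow> ('m \<Rightarrow> real list) \<Rightarrow> real" where
  "mu1u_tuple p q = (MAX i. mu1u (p i) (q i))"

definition asymptotically_uniformly_continuous_on ::
    "('m::finite \<Rightarrow> real list) set \<Rightarrow> (('m \<Rightarrow> real list) \<Rightarrow> real) \<Rightarrow> bool" where
  "asymptotically_uniformly_continuous_on X F \<longleftrightarrow>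
     (\<forall>\<epsilon>>0. \<exists>n. \<exists>\<delta>>0. \<forall>p\<in>X. \<forall>q\<in>X.
        (\<forall>i. length (p i) \<ge> n \<and> length (q i) \<ge> n) \<and> mu1u_tuple p q < \<delta> \<longrightarrow>
        \<bar>F p - F q\<bar> < \<epsilon>)"

definition near_seqs :: "nat \<Rightarrow> (nat \<Rightarrow> real) \<Rightarrow> (nat \<Rightarrow> real) \<Rightarrow> real \<Rightarrow> real list set" where
  "near_seqs k c \<alpha> \<delta> =
     {p \<in> unit_seqs. set p \<subseteq> c ` {1..k} \<and>
        (\<forall>j\<in>{1..k}. (\<alpha> j - \<delta>) * real (length p) \<le> real (count_list p (c j)) \<and>
                    real (count_list p (c j)) \<le> (\<alpha> j + \<delta>) * real (length p))}"

definition up_continuous ::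
    "(('m::finite \<Rightarrow> real list) \<Rightarrow> real) \<Rightarrow> ('m \<Rightarrow> nat) \<Rightarrow> ('m \<Rightarrow> nat \<Rightarrow> real) \<Rightarrow> ('m \<Rightarrow> nat \<Rightarrow> real) \<Rightarrow> bool" where
  "up_continuous F k c \<alpha> \<longleftrightarrow>
     (\<exists>\<delta>\<^sub>0>0. \<forall>\<delta>. 0 < \<delta> \<and> \<delta> < \<delta>\<^sub>0 \<longrightarrow>
        asymptotically_uniformly_continuous_on
          {p. \<forall>i. p i \<in> near_seqs (k i) (c i) (\<alpha> i) \<delta>} F) \<and>
     (\<forall>\<epsilon>>0. \<exists>\<delta>>0. \<exists>n\<^sub>0. \<forall>p\<in>unit_tuples. \<forall>q\<in>unit_tuples.
        (\<forall>i. length (p i) = length (q i) \<and> length (p i) > n\<^sub>0 \<and>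
             muinfo (p i) (q i) < \<delta> \<and>
             p i \<in> near_seqs (k i) (c i) (\<alpha> i) \<delta>) \<longrightarrow>
        \<bar>F p - F q\<bar> < \<epsilon>)"

definition unit_parameters ::
    "('m \<Rightarrow> nat) \<Rightarrow> ('m \<Rightarrow> nat \<Rightarrow> real) \<Rightarrow> ('m \<Rightarrow> nat \<Rightarrow> real) \<Rightarrow> bool" where
  "unit_parameters k c \<alpha> \<longleftrightarrow>
     (\<forall>i. k i \<ge> 1 \<and> (\<forall>j\<in>{1..k i}. c i j \<in> {0..1} \<and> \<alpha> i j \<in> {0..1}))"

end

theory Submission imports Defs begin

text \<open>
  A convergence testing sequence is, up to a vanishing perturbation of the entries, a sequence with
  entries in the finite set of the \<open>c\<close>'s and convergent frequencies. For sequences with entries in a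
  fixed finite set, \<open>\<mu>\<^sub>1\<^sup>u\<close> is equivalent to the distance between the frequency vectors.

  From ct- to up-continuity: a failure of either condition yields two sequences of tuples on which
  \<open>F\<close> stays apart; after passing to a subsequence along which the frequencies converge, both are
  convergence testing for the limit frequencies. Condition (1) thus needs ct-continuity
  for parameters \<open>\<alpha>\<close> other than the given ones, and holds for every \<open>\<delta>\<close>.

  Conversely, round all entries to the nearest \<open>c\<close>: condition (2) controls the rounding, and
  condition (1) compares the two rounded sequences.
\<close>

section \<open>Frequencies and quantile functions\<close>

text \<open>A predicate argument covers both point frequencies \<open>freq ((=) x)\<close> and
  values \<open>freq (\<lambda>y. y \<le> t) p\<close> of the empirical distribution
  function.\<close>

definition freq :: "('a \<Rightarrow> bool) \<Rightarrow> 'a list \<Rightarrow> real" where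
  "freq P p = real (length (filter P p)) / real (length p)"

lemma freq_nonneg: "0 \<le> freq P p"
  by (simp add: freq_def)

lemma freq_le_1: "freq P p \<le> 1"
  by (cases "p = []") (auto simp: freq_def)

lemma freq_eq_sum:
  assumes "finite C" "set p \<subseteq> C"
  shows "freq P p = (\<Sum>c | c \<in> C \<and> P c. freq ((=) c) p)"
proof -
  have "length (filter P p) = (\<Sum>c | c \<in> C \<and> P c. length (filter ((=) c) p))"
    using assms
  proof (induction p)
    case (Cons x p)
    have "(\<Sum>c | c \<in> C \<and> P c. length (filter ((=) c) (x # p)))
      = (\<Sum>c | c \<in> C \<and> P c. (if c = x then 1 else 0) + length (filter ((=) c) p))"
      by (rule sum.cong) auto
    also have "\<dots> = (if P x then 1 else 0) + length (filter P p)"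
      using Cons by (simp add: sum.distrib)
    finally show ?case by simp
  qed simp
  then show ?thesis by (simp add: freq_def sum_divide_distrib)
qed

text \<open>The entries at most \<open>t\<close> form an initial segment of a sorted list, so a
  position need only be compared with the length of that segment.\<close>

lemma sorted_nth_le_iff:
  fixes xs :: "'a::linorder list"
  assumes "sorted xs" "i < length xs"
  shows "xs ! i \<le> t \<longleftrightarrow> i < length (filter (\<lambda>x. x \<le> t) xs)"
  using assms
proof (induction xs arbitrary: i)
  case (Cons x xs)
  show ?case
  proof (cases "x \<le> t")
    case True
    then show ?thesis using Cons by (cases i) auto
  next
    case False
    then have "\<forall>y\<in>set (x # xs). \<not> y \<le> t" using Cons.prems by auto
    then have "filter (\<lambda>x. x \<le> t) (x # xs) = []" by (simp add: filter_empty_conv)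
    moreover have "(x # xs) ! i \<in> set (x # xs)" using Cons.prems(2) nth_mem by blast
    ultimately show ?thesis using \<open>\<forall>y\<in>set (x # xs). \<not> y \<le> t\<close> by auto
  qed
qed simp

section \<open>Step functions and quantile functions\<close>

definition rep_index :: "nat \<Rightarrow> real \<Rightarrow> nat" where
  "rep_index n a = (if a = 1 then n - 1 else nat \<lfloor>a * real n\<rfloor>)"

lemma rep_index_less:
  assumes "n > 0" "a \<in> {0..1}"
  shows "rep_index n a < n"
\<comment> \<open>At \<open>a = 1\<close> the floor would be \<open>n\<close>, one past the last
  position; hence the separate value \<open>n - 1\<close>.\<close>
proof (cases "a = 1")
  case False
  then have "a * real n < real n" using assms by simp
  then have "\<lfloor>a * real n\<rfloor> < int n" by linarith
  then show ?thesis using False assms by (simp add: rep_index_def nat_less_iff)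
qed (use assms in \<open>simp add: rep_index_def\<close>)

lemma fun_rep_eq: "p \<noteq> [] \<Longrightarrow> fun_rep p a = p ! rep_index (length p) a"
  by (simp add: fun_rep_def rep_index_def last_conv_nth)

lemma mon_rep_mem:
  assumes "p \<noteq> []" "x \<in> {0..1}"
  shows "mon_rep p x \<in> set p"
proof -
  have "sort p \<noteq> []" using assms(1) by (metis length_sort length_0_conv)
  then have "mon_rep p x = sort p ! rep_index (length p) x"
    by (simp add: mon_rep_def fun_rep_eq)
  then show ?thesis
    using rep_index_less[of "length p" x] assms nth_mem[of _ "sort p"] by auto
qed

text \<open>\<open>mon_rep p\<close> is the quantile function of the entries, inverse in this sense
  to their distribution function. The point \<open>1\<close> is excluded: if all entries are at most
  \<open>t\<close>, the left side holds there while \<open>1 < 1\<close> fails.\<close>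

lemma mon_rep_le_iff:
  assumes "p \<noteq> []" "x \<in> {0..<1}"
  shows "mon_rep p x \<le> t \<longleftrightarrow> x < freq (\<lambda>y. y \<le> t) p"
proof -
  let ?n = "length p" and ?m = "length (filter (\<lambda>y. y \<le> t) p)"
  have n: "real ?n > 0" using assms(1) by simp
  have "sort p \<noteq> []" using assms(1) by (metis length_sort length_0_conv)
  then have "mon_rep p x = sort p ! rep_index ?n x"
    by (simp add: mon_rep_def fun_rep_eq)
  moreover have "rep_index ?n x < ?n" using rep_index_less[of ?n x] assms by auto
  moreover have "length (filter (\<lambda>y. y \<le> t) (sort p)) = ?m"
    by (simp add: filter_sort)
  ultimately have "mon_rep p x \<le> t \<longleftrightarrow> rep_index ?n x < ?m"
    using sorted_nth_le_iff[of "sort p" "rep_index ?n x" t] by simp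
  also have "\<dots> \<longleftrightarrow> nat \<lfloor>x * real ?n\<rfloor> < ?m" using assms by (simp add: rep_index_def)
  also have "\<dots> \<longleftrightarrow> \<lfloor>x * real ?n\<rfloor> < int ?m" using assms by (simp add: nat_less_iff)
  also have "\<dots> \<longleftrightarrow> x * real ?n < real ?m" by linarith
  also have "\<dots> \<longleftrightarrow> x < freq (\<lambda>y. y \<le> t) p" using n by (simp add: freq_def field_simps)
  finally show ?thesis .
qed

lemma measurable_fun_rep [measurable]: "fun_rep p \<in> borel_measurable borel"
proof -
  have "(\<lambda>a. p ! nat \<lfloor>a * real (length p)\<rfloor>) \<in> borel_measurable borel"
    by (rule measurable_compose[where N = "count_space UNIV" and g = "\<lambda>i. p ! nat i"]) simp_all
  then show ?thesis
    unfolding fun_rep_def by (intro measurable_If) auto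
qed

section \<open>The integral distance in terms of frequencies\<close>

lemma has_integral_indicator_interval:
  fixes l u :: real
  assumes "0 \<le> l" "l \<le> u" "u \<le> 1"
  shows "((indicator {l..<u} :: real \<Rightarrow> real) has_integral (u - l)) {0..<1}"
proof -
  have "((\<lambda>x. 1::real) has_integral (u - l)) {l..u}"
    using has_integral_const_real[of "1::real" l u] assms by simp
  then have "((\<lambda>x. 1::real) has_integral (u - l)) {l..<u}"
    by (subst has_integral_spike_set_eq[of _ "{l..u}"]) (auto intro: negligible_subset[of "{u}"])
  then have "((\<lambda>x. if x \<in> {l..<u} then 1 else 0 :: real) has_integral (u - l)) {0..<1}"
    using assms by (subst has_integral_restrict) auto
  moreover have "(\<lambda>x. if x \<in> {l..<u} then 1 else 0 :: real) = indicator {l..<u}"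
    by (auto simp: indicator_def)
  ultimately show ?thesis by simp
qed

text \<open>Removing the null set \<open>{1}\<close> makes \<open>mon_rep_le_iff\<close> available
  on the whole domain of integration.\<close>

lemma mu1u_eq: "mu1u p q = integral {0..<1} (\<lambda>x. \<bar>mon_rep p x - mon_rep q x\<bar>)"
  unfolding mu1u_def
  by (rule integral_spike_set) (auto intro: negligible_subset[of "{1}"])

lemma integrable_mon_rep_diff:
  assumes "p \<in> unit_seqs" "q \<in> unit_seqs"
  shows "(\<lambda>x. \<bar>mon_rep p x - mon_rep q x\<bar>) integrable_on {0..<1}"
proof (rule measurable_bounded_by_integrable_imp_integrable)
  have "(\<lambda>x. \<bar>mon_rep p x - mon_rep q x\<bar>) \<in> borel_measurable borel"
    unfolding mon_rep_def by measurable
  then show "(\<lambda>x. \<bar>mon_rep p x - mon_rep q x\<bar>) \<in> borel_measurable (lebesgue_on {0..<1})"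
    by (intro measurable_restrict_space1 measurable_completion) simp
  show "(\<lambda>x::real. 1::real) integrable_on {0..<1}"
  proof (rule has_integral_integrable)
    show "((\<lambda>x::real. 1::real) has_integral (1 - 0)) {0..<1}"
      by (rule has_integral_eq[of _ "indicator {0..<1}"]) (use has_integral_indicator_interval[of 0 1] in auto)
  qed
  fix x :: real assume "x \<in> {0..<1}"
  then have "mon_rep p x \<in> {0..1}" "mon_rep q x \<in> {0..1}"
    using mon_rep_mem[of p x] mon_rep_mem[of q x] assms by (auto simp: unit_seqs_def)
  then show "norm \<bar>mon_rep p x - mon_rep q x\<bar> \<le> 1" by auto
qed auto

text \<open>Between the two frequencies exactly one of the two quantile functions is at most \<open>t\<close>.\<close>

lemma mu1u_lower:
  assumes pq: "p \<in> unit_seqs" "q \<in> unit_seqs" "set p \<subseteq> C" "set q \<subseteq> C"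
    and d: "d \<ge> 0" "\<And>x y. x \<in> C \<Longrightarrow> y \<in> C \<Longrightarrow> x \<noteq> y \<Longrightarrow> d \<le> \<bar>x - y\<bar>"
  shows "d * \<bar>freq (\<lambda>y. y \<le> t) p - freq (\<lambda>y. y \<le> t) q\<bar> \<le> mu1u p q"
proof -
  define a b where "a = freq (\<lambda>y. y \<le> t) p" and "b = freq (\<lambda>y. y \<le> t) q"
  have "0 \<le> min a b" "min a b \<le> max a b" "max a b \<le> 1"
    by (auto simp: a_def b_def freq_nonneg freq_le_1)
  \<comment> \<open>The minorant of the integrand: on this interval the two quantile values are
    distinct points of \<open>C\<close>, hence at least \<open>d\<close> apart.\<close>
  then have I: "((\<lambda>x. d * indicator {min a b..<max a b} x) has_integral d * (max a b - min a b)) {0..<1}"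
    by (intro has_integral_mult_right has_integral_indicator_interval)
  have "d * (max a b - min a b) \<le> mu1u p q"
    unfolding mu1u_eq
  proof (rule has_integral_le[OF I])
    show "((\<lambda>x. \<bar>mon_rep p x - mon_rep q x\<bar>) has_integral
        integral {0..<1} (\<lambda>x. \<bar>mon_rep p x - mon_rep q x\<bar>)) {0..<1}"
      using integrable_mon_rep_diff[OF pq(1,2)] by (rule integrable_integral)
    fix x :: real assume x: "x \<in> {0..<1}"
    have ne: "p \<noteq> []" "q \<noteq> []" using pq by (auto simp: unit_seqs_def)
    have "mon_rep p x \<in> C" "mon_rep q x \<in> C"
      using mon_rep_mem[of p x] mon_rep_mem[of q x] x ne pq by auto
    moreover have "mon_rep p x \<noteq> mon_rep q x" if "x \<in> {min a b..<max a b}"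
      using that mon_rep_le_iff[OF ne(1) x, of t] mon_rep_le_iff[OF ne(2) x, of t]
      by (auto simp: a_def b_def)
    ultimately show "d * indicator {min a b..<max a b} x \<le> \<bar>mon_rep p x - mon_rep q x\<bar>"
      using d by (auto simp: indicator_def)
  qed
  moreover have "max a b - min a b = \<bar>a - b\<bar>" by auto
  ultimately show ?thesis by (simp add: a_def b_def)
qed

text \<open>The integrand is at most 1, and where it is nonzero some threshold in \<open>C\<close>
  has \<open>x\<close> between its two frequencies. So it is dominated by the sum of the indicators
  of these intervals.\<close>

lemma mu1u_upper:
  assumes pq: "p \<in> unit_seqs" "q \<in> unit_seqs" "set p \<subseteq> C" "set q \<subseteq> C" and C: "finite C"
  shows "mu1u p q \<le> (\<Sum>t\<in>C. \<bar>freq (\<lambda>y. y \<le> t) p - freq (\<lambda>y. y \<le> t) q\<bar>)"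
proof -
  define a b where "a t = freq (\<lambda>y. y \<le> t) p" and "b t = freq (\<lambda>y. y \<le> t) q" for t
  have *: "0 \<le> min (a t) (b t)" "min (a t) (b t) \<le> max (a t) (b t)" "max (a t) (b t) \<le> 1" for t
    by (auto simp: a_def b_def freq_nonneg freq_le_1)
  then have I: "((\<lambda>x. \<Sum>t\<in>C. indicator {min (a t) (b t)..<max (a t) (b t)} x :: real)
      has_integral (\<Sum>t\<in>C. max (a t) (b t) - min (a t) (b t))) {0..<1}"
    by (intro has_integral_sum C has_integral_indicator_interval)
  have "mu1u p q \<le> (\<Sum>t\<in>C. max (a t) (b t) - min (a t) (b t))"
    unfolding mu1u_eq
  proof (rule has_integral_le[OF _ I])
    show "((\<lambda>x. \<bar>mon_rep p x - mon_rep q x\<bar>) has_integral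
        integral {0..<1} (\<lambda>x. \<bar>mon_rep p x - mon_rep q x\<bar>)) {0..<1}"
      using integrable_mon_rep_diff[OF pq(1,2)] by (rule integrable_integral)
    fix x :: real assume x: "x \<in> {0..<1}"
    define u v where "u = mon_rep p x" and "v = mon_rep q x"
    have ne: "p \<noteq> []" "q \<noteq> []" using pq by (auto simp: unit_seqs_def)
    have mem: "u \<in> set p" "v \<in> set q"
      using mon_rep_mem[of p x] mon_rep_mem[of q x] x ne by (auto simp: u_def v_def)
    have le: "u \<le> t \<longleftrightarrow> x < a t" "v \<le> t \<longleftrightarrow> x < b t" for t
      using mon_rep_le_iff[OF ne(1) x] mon_rep_le_iff[OF ne(2) x]
      by (auto simp: a_def b_def u_def v_def)
    have nn: "(0::real) \<le> (\<Sum>t\<in>C. indicator {min (a t) (b t)..<max (a t) (b t)} x)"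
      by (intro sum_nonneg) (simp add: indicator_def)
    show "\<bar>mon_rep p x - mon_rep q x\<bar> \<le> (\<Sum>t\<in>C. indicator {min (a t) (b t)..<max (a t) (b t)} x)"
    proof (cases "u = v")
      case True
      then show ?thesis using nn by (simp add: u_def v_def)
    next
      case False
      \<comment> \<open>Exactly one of \<open>u\<close> and \<open>v\<close> is at most
        \<open>min u v\<close>, so this threshold has \<open>x\<close> between its two
        frequencies.\<close>
      have "x \<in> {min (a (min u v)) (b (min u v))..<max (a (min u v)) (b (min u v))}"
        using False le(1)[of u] le(1)[of v] le(2)[of u] le(2)[of v] by (auto simp: min_def max_def split: if_splits)
      moreover have "min u v \<in> C" using mem pq by (auto simp: min_def)
      ultimately have "(1::real) \<le> (\<Sum>t\<in>C. indicator {min (a t) (b t)..<max (a t) (b t)} x)"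
        using member_le_sum[of "min u v" C "\<lambda>t. indicator {min (a t) (b t)..<max (a t) (b t)} x :: real"] C
        by (simp add: indicator_def)
      moreover have "\<bar>u - v\<bar> \<le> 1"
      proof -
        have "u \<in> {0..1}" "v \<in> {0..1}" using mem pq by (auto simp: unit_seqs_def)
      then show ?thesis by auto
      qed
      ultimately show ?thesis unfolding u_def v_def by linarith
    qed
  qed
  also have "\<dots> = (\<Sum>t\<in>C. \<bar>a t - b t\<bar>)" by (rule sum.cong) auto
  finally show ?thesis by (simp add: a_def b_def)
qed

section \<open>The supremum distance as an entrywise distance\<close>

lemma muinfo_less_imp:
  assumes "length p = length q" "muinfo p q < \<delta>"
  shows "list_all2 (\<lambda>x y. \<bar>x - y\<bar> \<le> \<delta>) p q"
proof (rule list_all2_all_nthI[OF assms(1)])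
  fix i assume i: "i < length p"
  let ?n = "length p"
  have ne: "p \<noteq> []" "q \<noteq> []" using i assms by auto
  have ran: "fun_rep p a - fun_rep q a \<in> (\<lambda>(x, y). x - y) ` (set p \<times> set q)" if "a \<in> {0..1}" for a
    using rep_index_less[of ?n a] that ne assms(1) by (force simp: fun_rep_eq)
  \<comment> \<open>A real \<open>SUP\<close> is known to be an upper bound only for bounded
    families; here the values are differences of entries of two lists, hence finitely many.\<close>
  have "bdd_above ((\<lambda>a. \<bar>fun_rep p a - fun_rep q a\<bar>) ` {0..1})"
    by (rule bdd_above_mono[of "abs ` (\<lambda>(x, y). x - y) ` (set p \<times> set q)"])
      (use ran in \<open>auto intro!: bdd_above_finite\<close>)
  moreover have "real i / real ?n \<in> {0..1}" using i by (simp add: divide_le_eq_1)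
  ultimately have "\<bar>fun_rep p (real i / real ?n) - fun_rep q (real i / real ?n)\<bar> \<le> muinfo p q"
    unfolding muinfo_def by (intro cSUP_upper)
  \<comment> \<open>Equal lengths give equal partitions, so both step functions show their entry
    \<open>i\<close> at the left endpoint \<open>i / n\<close>.\<close>
  moreover have "real i / real ?n \<in> {real i / real ?n..<real (i + 1) / real ?n}"
    using i by (auto intro!: divide_strict_right_mono)
  then have "fun_rep p (real i / real ?n) = p ! i" "fun_rep q (real i / real ?n) = q ! i"
    using fun_rep_eq_nth[of i p] fun_rep_eq_nth[of i q] i assms(1) by auto
  ultimately show "\<bar>p ! i - q ! i\<bar> \<le> \<delta>" using assms(2) by simp
qed

text \<open>At each point both step functions read the same position, so an entrywise bound passes
  to the supremum.\<close>

lemma muinfo_le: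
  assumes "p \<noteq> []" "list_all2 (\<lambda>x y. \<bar>x - y\<bar> \<le> r) p q"
  shows "muinfo p q \<le> r"
  unfolding muinfo_def
proof (rule cSUP_least)
  fix a :: real assume "a \<in> {0..1}"
  then have "rep_index (length p) a < length p" using assms by (intro rep_index_less) auto
  moreover have "length p = length q" using assms(2) by (rule list_all2_lengthD)
  moreover have "q \<noteq> []" using assms \<open>length p = length q\<close> by auto
  ultimately show "\<bar>fun_rep p a - fun_rep q a\<bar> \<le> r"
    using assms by (simp add: fun_rep_eq list_all2_conv_all_nth)
qed auto

section \<open>Finite sets of values and point frequencies\<close>

lemma finite_separated:
  fixes C :: "real set"
  assumes "finite C"
  obtains d where "d > 0" "\<And>x y. x \<in> C \<Longrightarrow> y \<in> C \<Longrightarrow> x \<noteq> y \<Longrightarrow> d \<le> \<bar>x - y\<bar>"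
proof
  \<comment> \<open>The inserted \<open>1\<close> keeps the set nonempty when \<open>C\<close> has
    at most one point.\<close>
  let ?D = "insert 1 ((\<lambda>(x, y). \<bar>x - y\<bar>) ` {(x, y) \<in> C \<times> C. x \<noteq> y})"
  have fin: "finite ?D"
    using assms by (intro finite.insertI finite_imageI) (auto intro: finite_subset[of _ "C \<times> C"])
  show "Min ?D > 0" by (subst Min_gr_iff[OF fin]) auto
  fix x y assume "x \<in> C" "y \<in> C" "x \<noteq> y"
  then have "\<bar>x - y\<bar> \<in> ?D" by force
  then show "Min ?D \<le> \<bar>x - y\<bar>" by (rule Min_le[OF fin])
qed

text \<open>A point frequency is the jump of the distribution function at \<open>x\<close>. As no
  point of \<open>C\<close> lies strictly between \<open>x - d / 2\<close> and \<open>x\<close>, it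
  is the difference of two values of that function, each controlled by \<open>mu1u_lower\<close>;
  hence the factor 2.\<close>

lemma freq_diff_le_mu1u:
  assumes pq: "p \<in> unit_seqs" "q \<in> unit_seqs" "set p \<subseteq> C" "set q \<subseteq> C"
    and d: "d > 0" "\<And>x y. x \<in> C \<Longrightarrow> y \<in> C \<Longrightarrow> x \<noteq> y \<Longrightarrow> d \<le> \<bar>x - y\<bar>"
    and x: "x \<in> C"
  shows "d * \<bar>freq ((=) x) p - freq ((=) x) q\<bar> \<le> 2 * mu1u p q"
proof -
  have C: "y \<le> x \<longleftrightarrow> y = x \<or> y \<le> x - d / 2" if "y \<in> C" for y
    using d(2)[OF that x] d(1) by (cases "y = x") auto
  have "length (filter (\<lambda>y. y \<le> x) p)
      = length (filter ((=) x) p) + length (filter (\<lambda>y. y \<le> x - d / 2) p)"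
    if "set p \<subseteq> C" for p
    using that
  proof (induction p)
    case (Cons y p)
    then show ?case using C[of y] d(1) by (cases "y = x") auto
  qed simp
  then have *: "freq ((=) x) p = freq (\<lambda>y. y \<le> x) p - freq (\<lambda>y. y \<le> x - d / 2) p"
    if "set p \<subseteq> C" for p
    using that by (simp add: freq_def add_divide_distrib)
  have lower: "d * \<bar>freq (\<lambda>y. y \<le> t) p - freq (\<lambda>y. y \<le> t) q\<bar> \<le> mu1u p q" for t
    by (rule mu1u_lower[OF pq less_imp_le[OF d(1)] d(2)])
  have "d * \<bar>freq ((=) x) p - freq ((=) x) q\<bar>
      \<le> d * (\<bar>freq (\<lambda>y. y \<le> x) p - freq (\<lambda>y. y \<le> x) q\<bar>
        + \<bar>freq (\<lambda>y. y \<le> x - d / 2) p - freq (\<lambda>y. y \<le> x - d / 2) q\<bar>)"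
    unfolding *[OF pq(3)] *[OF pq(4)] using d(1) by (intro mult_left_mono) arith+
  also have "\<dots> \<le> 2 * mu1u p q"
    using lower[of x] lower[of "x - d / 2"] by (simp add: distrib_left)
  finally show ?thesis .
qed

text \<open>Each of the \<open>card C\<close> thresholds in \<open>mu1u_upper\<close> contributes at
  most the sum of all differences of point frequencies.\<close>

lemma mu1u_le_freq_diff:
  assumes pq: "p \<in> unit_seqs" "q \<in> unit_seqs" "set p \<subseteq> C" "set q \<subseteq> C" and C: "finite C"
  shows "mu1u p q \<le> real (card C) * (\<Sum>x\<in>C. \<bar>freq ((=) x) p - freq ((=) x) q\<bar>)"
proof -
  let ?s = "\<Sum>x\<in>C. \<bar>freq ((=) x) p - freq ((=) x) q\<bar>"
  have "\<bar>freq (\<lambda>y. y \<le> t) p - freq (\<lambda>y. y \<le> t) q\<bar> \<le> ?s" for t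
  proof -
    have "freq (\<lambda>y. y \<le> t) p - freq (\<lambda>y. y \<le> t) q
        = (\<Sum>x | x \<in> C \<and> x \<le> t. freq ((=) x) p - freq ((=) x) q)"
      by (simp only: freq_eq_sum[OF C pq(3), of "\<lambda>y. y \<le> t"]
          freq_eq_sum[OF C pq(4), of "\<lambda>y. y \<le> t"] sum_subtractf)
    also have "\<bar>\<dots>\<bar> \<le> (\<Sum>x | x \<in> C \<and> x \<le> t. \<bar>freq ((=) x) p - freq ((=) x) q\<bar>)"
      by (rule sum_abs)
    also have "\<dots> \<le> ?s" using C by (intro sum_mono2) auto
    finally show ?thesis .
  qed
  then have "(\<Sum>t\<in>C. \<bar>freq (\<lambda>y. y \<le> t) p - freq (\<lambda>y. y \<le> t) q\<bar>) \<le> real (card C) * ?s"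
    by (intro sum_bounded_above)
  then show ?thesis using mu1u_upper[OF pq C] by linarith
qed

text \<open>Division by the positive length turns the bounds on counts into closeness of
  frequencies.\<close>

lemma near_seqs_iff:
  "p \<in> near_seqs k c \<alpha> \<delta> \<longleftrightarrow> p \<in> unit_seqs \<and> set p \<subseteq> c ` {1..k} \<and>
    (\<forall>j\<in>{1..k}. \<bar>freq ((=) (c j)) p - \<alpha> j\<bar> \<le> \<delta>)"
proof -
  have count: "count_list p x = length (filter ((=) x) p)" for x
    by (induction p) auto
  have "(\<alpha> j - \<delta>) * real (length p) \<le> real (count_list p (c j)) \<and>
      real (count_list p (c j)) \<le> (\<alpha> j + \<delta>) * real (length p)
    \<longleftrightarrow> \<bar>freq ((=) (c j)) p - \<alpha> j\<bar> \<le> \<delta>" if "p \<in> unit_seqs" for j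
  proof -
    have "real (length p) > 0" using that by (simp add: unit_seqs_def)
    then have "(\<alpha> j - \<delta>) * real (length p) \<le> real (count_list p (c j)) \<longleftrightarrow> \<alpha> j - \<delta> \<le> freq ((=) (c j)) p"
      "real (count_list p (c j)) \<le> (\<alpha> j + \<delta>) * real (length p) \<longleftrightarrow> freq ((=) (c j)) p \<le> \<alpha> j + \<delta>"
      by (simp_all add: freq_def count pos_le_divide_eq pos_divide_le_eq)
    then show ?thesis by (auto simp: abs_le_iff)
  qed
  then show ?thesis unfolding near_seqs_def by blast
qed

section \<open>Convergence testing sequences\<close>

text \<open>The limits \<open>\<beta>\<close> are indexed by the points of \<open>C\<close>
  themselves, so that no enumeration has to be chosen. The sequence \<open>q\<close> holds the
  rounded entries and \<open>\<delta>\<close> bounds the displacement.\<close>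

definition clusters_at :: "real set \<Rightarrow> (real \<Rightarrow> real) \<Rightarrow> (nat \<Rightarrow> real list) \<Rightarrow> bool" where
  "clusters_at C \<beta> p \<longleftrightarrow>
    (\<forall>n. p n \<in> unit_seqs) \<and> (\<forall>n. length (p n) < length (p (Suc n))) \<and>
    (\<exists>q \<delta>. \<delta> \<longlonglongrightarrow> 0 \<and>
      (\<forall>n. set (q n) \<subseteq> C \<and> list_all2 (\<lambda>x y. \<bar>x - y\<bar> \<le> \<delta> n) (q n) (p n)) \<and>
      (\<forall>x\<in>C. (\<lambda>n. freq ((=) x) (q n)) \<longlonglongrightarrow> \<beta> x))"

text \<open>Once \<open>\<delta> n\<close> is small, an entry of \<open>p n\<close> whose rounding
  is \<open>c l\<close> lies in \<open>I l\<close>, and by disjointness in no other interval. From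
  then on the frequency of \<open>I j\<close> in \<open>p n\<close> is that of \<open>c j\<close> in
  \<open>q n\<close>.\<close>

lemma clusters_at_imp_convergence_testing:
  assumes inj: "inj_on c {1..k}" and c: "c ` {1..k} \<subseteq> {0..1}"
    and p: "clusters_at (c ` {1..k}) \<beta> p"
  shows "convergence_testing k c (\<lambda>j. \<beta> (c j)) p"
proof -
  obtain q \<delta> where \<delta>: "\<delta> \<longlonglongrightarrow> 0"
    and q_close: "\<forall>n. set (q n) \<subseteq> c ` {1..k} \<and> list_all2 (\<lambda>x y. \<bar>x - y\<bar> \<le> \<delta> n) (q n) (p n)"
    and lim: "\<forall>x\<in>c ` {1..k}. (\<lambda>n. freq ((=) x) (q n)) \<longlonglongrightarrow> \<beta> x"
    using p unfolding clusters_at_def by (elim conjE exE) (rule that)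
  have q: "set (q n) \<subseteq> c ` {1..k}" and close: "list_all2 (\<lambda>x y. \<bar>x - y\<bar> \<le> \<delta> n) (q n) (p n)" for n
    using q_close by simp_all
  have unit: "p n \<in> unit_seqs" and len: "length (p n) < length (p (Suc n))" for n
    using p by (simp_all add: clusters_at_def)
  have len_eq: "length (q n) = length (p n)" for n
    using close list_all2_lengthD by blast
  show ?thesis
    unfolding convergence_testing_def
  proof (intro conjI allI impI ballI)
    fix I
    assume I: "disjoint_family_on I {1..k} \<and>
      (\<forall>j\<in>{1..k}. is_interval (I j) \<and> openin (top_of_set {0..1}) (I j) \<and> c j \<in> I j)"
    \<comment> \<open>Relative openness gives a radius for each \<open>j\<close>, and
      \<open>\<delta> n\<close> is eventually below all of these finitely many radii.\<close>
    have "\<forall>\<^sub>F n in sequentially. \<forall>j\<in>{1..k}. \<forall>x\<in>{0..1}. \<bar>c j - x\<bar> \<le> \<delta> n \<longrightarrow> x \<in> I j"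
    proof (rule eventually_ball_finite, simp, rule ballI)
      fix j assume "j \<in> {1..k}"
      then have "openin (top_of_set {0..1}) (I j)" "c j \<in> I j" using I by auto
      then obtain r where r: "r > 0" "\<And>x. x \<in> {0..1} \<Longrightarrow> dist x (c j) < r \<Longrightarrow> x \<in> I j"
        unfolding openin_euclidean_subtopology_iff by blast
      have "\<forall>\<^sub>F n in sequentially. \<delta> n < r" using \<delta> r(1) by (rule order_tendstoD)
      then show "\<forall>\<^sub>F n in sequentially. \<forall>x\<in>{0..1}. \<bar>c j - x\<bar> \<le> \<delta> n \<longrightarrow> x \<in> I j"
        by eventually_elim (auto intro!: r(2) simp: dist_real_def)
    qed
    then have ev: "\<forall>\<^sub>F n in sequentially. \<forall>i<length (p n). \<exists>l\<in>{1..k}. q n ! i = c l \<and> p n ! i \<in> I l"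
    proof eventually_elim
      case (elim n)
      show ?case
      proof (intro allI impI)
        fix i assume i: "i < length (p n)"
        then have "q n ! i \<in> set (q n)" by (simp add: len_eq)
        then obtain l where "l \<in> {1..k}" "q n ! i = c l" using q by blast
        moreover have "p n ! i \<in> {0..1}" using unit[of n] nth_mem[OF i] by (auto simp: unit_seqs_def)
        moreover have "\<bar>q n ! i - p n ! i\<bar> \<le> \<delta> n"
          using close[of n] i by (auto simp: list_all2_conv_all_nth)
        ultimately show "\<exists>l\<in>{1..k}. q n ! i = c l \<and> p n ! i \<in> I l" using elim by auto
      qed
    qed
    then have "\<forall>\<^sub>F n in sequentially. set (p n) \<subseteq> (\<Union>j\<in>{1..k}. I j)"
      by eventually_elim (fastforce simp: in_set_conv_nth)
    then show "\<exists>N. \<forall>n\<ge>N. set (p n) \<subseteq> (\<Union>j\<in>{1..k}. I j)"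
      by (simp add: eventually_sequentially)
    fix j assume j: "j \<in> {1..k}"
    from ev have "\<forall>\<^sub>F n in sequentially. freq ((=) (c j)) (q n)
      = real (card {i. i < length (p n) \<and> p n ! i \<in> I j}) / real (length (p n))"
    proof eventually_elim
      case (elim n)
      have "c j = q n ! i \<longleftrightarrow> p n ! i \<in> I j" if i: "i < length (p n)" for i
      proof -
        obtain l where l: "l \<in> {1..k}" "q n ! i = c l" "p n ! i \<in> I l" using elim i by blast
        have "p n ! i \<in> I j \<longleftrightarrow> j = l"
          using I l(1,3) j unfolding disjoint_family_on_def by blast
        then show ?thesis using inj_onD[OF inj, of j l] l(1,2) j by auto
      qed
      then have "{i. i < length (p n) \<and> c j = q n ! i} = {i. i < length (p n) \<and> p n ! i \<in> I j}"
        by blast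
      then show ?case by (simp add: freq_def length_filter_conv_card len_eq)
    qed
    then show "(\<lambda>n. real (card {i. i < length (p n) \<and> p n ! i \<in> I j}) / real (length (p n)))
        \<longlonglongrightarrow> \<beta> (c j)"
      by (rule Lim_transform_eventually[OF lim[rule_format], rotated]) (use j in auto)
  qed (use unit len in auto)
qed

text \<open>Enumerating each \<open>C i\<close> bijectively gives pairwise distinct parameters, to
  which the hypothesis on \<open>F\<close> applies.\<close>

lemma ct_continuous_clusters_at:
  fixes F :: "('m::finite \<Rightarrow> real list) \<Rightarrow> real"
  assumes ct: "\<And>k c \<alpha>. unit_parameters k c \<alpha> \<Longrightarrow> \<forall>i. inj_on (c i) {1..k i} \<Longrightarrow> ct_continuous F k c \<alpha>"
    and C: "\<And>i. finite (C i)" "\<And>i. C i \<noteq> {}" "\<And>i. C i \<subseteq> {0..1}"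
    and p: "\<And>i. clusters_at (C i) (\<beta> i) (\<lambda>n. p n i)"
    and q: "\<And>i. clusters_at (C i) (\<beta> i) (\<lambda>n. q n i)"
  shows "(\<lambda>n. \<bar>F (p n) - F (q n)\<bar>) \<longlonglongrightarrow> 0"
proof -
  define k where "k i = card (C i)" for i
  obtain c where c: "\<And>i. bij_betw (c i) {1..k i} (C i)"
    using ex_bij_betw_nat_finite_1[OF C(1)] unfolding k_def by metis
  have im: "c i ` {1..k i} = C i" and inj: "inj_on (c i) {1..k i}" for i
    using c[of i] by (auto simp: bij_betw_def)
  \<comment> \<open>Limits of frequencies stay in \<open>{0..1}\<close>, which makes them admissible
    parameters.\<close>
  have \<beta>: "\<beta> i x \<in> {0..1}" if "x \<in> C i" for i x
  proof -
    obtain q where "\<forall>x\<in>C i. (\<lambda>n. freq ((=) x) (q n)) \<longlonglongrightarrow> \<beta> i x"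
      using p[of i] unfolding clusters_at_def by (elim conjE exE) (rule that)
    then have "(\<lambda>n. freq ((=) x) (q n)) \<longlonglongrightarrow> \<beta> i x" using that by blast
    then have "0 \<le> \<beta> i x" "\<beta> i x \<le> 1"
      using freq_nonneg freq_le_1 by (blast intro: LIMSEQ_le_const LIMSEQ_le_const2)+
    then show ?thesis by simp
  qed
  have "k i \<ge> 1" for i using C[of i] by (simp add: k_def Suc_le_eq card_gt_0_iff)
  moreover have "c i j \<in> {0..1} \<and> \<beta> i (c i j) \<in> {0..1}" if "j \<in> {1..k i}" for i j
  proof -
    have "c i j \<in> C i" using that im by blast
    then show ?thesis using \<beta> C(3) by blast
  qed
  ultimately have "unit_parameters k c (\<lambda>i j. \<beta> i (c i j))"
    unfolding unit_parameters_def by blast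
  then have "ct_continuous F k c (\<lambda>i j. \<beta> i (c i j))" using ct inj by blast
  moreover have "convergence_testing_tuple k c (\<lambda>i j. \<beta> i (c i j)) p"
    "convergence_testing_tuple k c (\<lambda>i j. \<beta> i (c i j)) q"
    unfolding convergence_testing_tuple_def
    by (intro allI clusters_at_imp_convergence_testing inj; use p q C(3) im in simp)+
  ultimately show ?thesis unfolding ct_continuous_def by blast
qed

section \<open>Extraction of sequences and subsequences\<close>

lemma growing_sequences:
  fixes R :: "real \<Rightarrow> ('m::finite \<Rightarrow> 'a list) \<Rightarrow> ('m \<Rightarrow> 'a list) \<Rightarrow> bool"
  assumes R: "\<And>\<delta> N. \<delta> > 0 \<Longrightarrow> \<exists>p q. R \<delta> p q \<and> (\<forall>i. N < length (p i) \<and> N < length (q i))"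
  obtains p q where "\<And>n. R (1 / real (Suc n)) (p n) (q n)"
    "\<And>n i. length (p n i) < length (p (Suc n) i)"
    "\<And>n i. length (q n i) < length (q (Suc n) i)"
proof -
  have "\<exists>f. \<forall>n. R (1 / real (Suc n)) (fst (f n)) (snd (f n)) \<and>
    (\<forall>i. length (fst (f n) i) < length (fst (f (Suc n)) i) \<and>
         length (snd (f n) i) < length (snd (f (Suc n)) i))"
  \<comment> \<open>Plain choice for each tolerance would not give increasing lengths, so each pair
    is chosen depending on the previous one.\<close>
  proof (rule dependent_nat_choice)
    show "\<exists>x. R (1 / real (Suc 0)) (fst x) (snd x)" using R[of 1 0] by auto
    fix x :: "('m \<Rightarrow> 'a list) \<times> ('m \<Rightarrow> 'a list)" and n
    \<comment> \<open>The sum dominates each of the finitely many lengths at once.\<close>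
    define N where "N = (\<Sum>i\<in>UNIV. length (fst x i) + length (snd x i))"
    have "length (fst x i) + length (snd x i) \<le> N" for i
      unfolding N_def by (rule member_le_sum) auto
    moreover obtain p q where "R (1 / real (Suc (Suc n))) p q"
      "\<And>i. N < length (p i) \<and> N < length (q i)"
      using R[of "1 / real (Suc (Suc n))" N] by auto
    ultimately show "\<exists>y. R (1 / real (Suc (Suc n))) (fst y) (snd y) \<and>
      (\<forall>i. length (fst x i) < length (fst y i) \<and> length (snd x i) < length (snd y i))"
      by (intro exI[of _ "(p, q)"])
        (auto, metis add_leE le_less_trans, metis add_leE le_less_trans)
  qed
  then show ?thesis using that[of "\<lambda>n. fst (f n)" "\<lambda>n. snd (f n)" for f] by blast
qed

text \<open>Sequential compactness of \<open>{0..1}\<close> is applied to one \<open>s\<close> at a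
  time; later refinements preserve the convergence already obtained.\<close>

lemma convergent_subseq_finite:
  fixes f :: "nat \<Rightarrow> 'a \<Rightarrow> real"
  assumes "finite S" "\<And>n s. f n s \<in> {0..1}"
  shows "\<exists>r::nat \<Rightarrow> nat. strict_mono r \<and> (\<forall>s\<in>S. convergent (\<lambda>n. f (r n) s))"
  using assms(1)
proof induction
  case empty
  then show ?case using strict_mono_id by auto
next
  case (insert s S)
  then obtain r :: "nat \<Rightarrow> nat" where r: "strict_mono r" "\<And>s. s \<in> S \<Longrightarrow> convergent (\<lambda>n. f (r n) s)" by auto
  obtain l r' where r': "strict_mono r'" "((\<lambda>n. f (r n) s) \<circ> r') \<longlonglongrightarrow> l"
    using compact_imp_seq_compact[OF compact_Icc, of "0::real" 1] assms(2)
    unfolding seq_compact_def by metis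
  have "convergent (\<lambda>n. f ((r \<circ> r') n) s')" if "s' \<in> insert s S" for s'
  proof (cases "s' = s")
    case True
    then show ?thesis using r' by (auto simp: convergent_def o_def)
  next
    case False
    then have "convergent ((\<lambda>n. f (r n) s') \<circ> r')"
      using r(2)[of s'] r'(1) that convergent_subseq_convergent by auto
    then show ?thesis by (simp add: o_def)
  qed
  moreover have "strict_mono (r \<circ> r')" using r(1) r'(1) by (rule strict_mono_o)
  ultimately show ?case by blast
qed

lemma inverse_Suc_tendsto: "(\<lambda>n. 1 / real (Suc n)) \<longlonglongrightarrow> 0"
  using LIMSEQ_inverse_real_of_nat by (simp add: inverse_eq_divide)

text \<open>If the entries already lie in \<open>C\<close>, the sequence is its own rounding, with
  displacement 0.\<close>

lemma clusters_atI:
  assumes "\<And>n. p n \<in> unit_seqs" "\<And>n. length (p n) < length (p (Suc n))" "\<And>n. set (p n) \<subseteq> C"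
    "\<And>x. x \<in> C \<Longrightarrow> (\<lambda>n. freq ((=) x) (p n)) \<longlonglongrightarrow> \<beta> x"
  shows "clusters_at C \<beta> p"
  unfolding clusters_at_def using assms
  by (intro conjI exI[of _ p] exI[of _ "\<lambda>_. 0"]) (auto simp: list_all2_same)

lemma mu1u_le_mu1u_tuple: "mu1u (p i) (q i) \<le> mu1u_tuple p q"
  unfolding mu1u_tuple_def by (rule Max_ge) auto

section \<open>From ct-continuity to up-continuity\<close>

text \<open>A counterexample gives two sequences with vanishing integral distance, hence with the
  same limit frequencies along a subsequence. Finite ranges are what \<open>X\<close> must have, so
  all the sets in condition (1) are covered.\<close>

lemma asymptotically_uniformly_continuous_finite_range:
  fixes F :: "('m::finite \<Rightarrow> real list) \<Rightarrow> real"
  assumes ct: "\<And>k c \<alpha>. unit_parameters k c \<alpha> \<Longrightarrow> \<forall>i. inj_on (c i) {1..k i} \<Longrightarrow> ct_continuous F k c \<alpha>"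
    and C: "\<And>i. finite (C i)" "\<And>i. C i \<noteq> {}" "\<And>i. C i \<subseteq> {0..1}"
    and X: "X \<subseteq> {p. \<forall>i. p i \<in> unit_seqs \<and> set (p i) \<subseteq> C i}"
  shows "asymptotically_uniformly_continuous_on X F"
proof (rule ccontr)
  assume "\<not> ?thesis"
  then obtain \<epsilon> where \<epsilon>: "\<epsilon> > 0"
    and bad: "\<And>N \<delta>. \<delta> > 0 \<Longrightarrow> \<exists>p\<in>X. \<exists>q\<in>X. (\<forall>i. length (p i) \<ge> N \<and> length (q i) \<ge> N) \<and>
      mu1u_tuple p q < \<delta> \<and> \<not> \<bar>F p - F q\<bar> < \<epsilon>"
    unfolding asymptotically_uniformly_continuous_on_def by metis
  have "\<exists>p q. (p \<in> X \<and> q \<in> X \<and> mu1u_tuple p q < \<delta> \<and> \<not> \<bar>F p - F q\<bar> < \<epsilon>) \<and>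
      (\<forall>i. N < length (p i) \<and> N < length (q i))" if "\<delta> > 0" for \<delta> N
    using bad[OF that, of "Suc N"] by (metis Suc_le_lessD)
  then obtain p q
    where pq: "\<And>n. p n \<in> X \<and> q n \<in> X \<and> mu1u_tuple (p n) (q n) < 1 / real (Suc n) \<and> \<not> \<bar>F (p n) - F (q n)\<bar> < \<epsilon>"
      and len: "\<And>n i. length (p n i) < length (p (Suc n) i)" "\<And>n i. length (q n i) < length (q (Suc n) i)"
    using growing_sequences[of "\<lambda>\<delta> p q. p \<in> X \<and> q \<in> X \<and> mu1u_tuple p q < \<delta> \<and> \<not> \<bar>F p - F q\<bar> < \<epsilon>"]
    by blast
  have p: "p n i \<in> unit_seqs" "set (p n i) \<subseteq> C i" and q: "q n i \<in> unit_seqs" "set (q n i) \<subseteq> C i" for n i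
    using pq[of n] X by auto
  \<comment> \<open>There are only finitely many pairs of a coordinate and a value, so one
    subsequence serves all of them.\<close>
  obtain r :: "nat \<Rightarrow> nat" where r: "strict_mono r"
    "\<forall>s\<in>Sigma UNIV C. convergent (\<lambda>n. (\<lambda>(i, x). freq ((=) x) (p (r n) i)) s)"
    using convergent_subseq_finite[of "Sigma UNIV C" "\<lambda>n (i, x). freq ((=) x) (p n i)"] C(1)
    by (auto simp: freq_nonneg freq_le_1)
  define \<beta> where "\<beta> i x = lim (\<lambda>n. freq ((=) x) (p (r n) i))" for i x
  have \<beta>p: "(\<lambda>n. freq ((=) x) (p (r n) i)) \<longlonglongrightarrow> \<beta> i x" if "x \<in> C i" for i x
    using r(2) that unfolding \<beta>_def by (auto simp: convergent_LIMSEQ_iff)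
  \<comment> \<open>The frequencies in \<open>q\<close> inherit the limits of those in
    \<open>p\<close>, because their differences are bounded by a multiple of the integral
    distance.\<close>
  have \<beta>q: "(\<lambda>n. freq ((=) x) (q (r n) i)) \<longlonglongrightarrow> \<beta> i x" if x: "x \<in> C i" for i x
  proof -
    obtain d where d: "d > 0" "\<And>x y. x \<in> C i \<Longrightarrow> y \<in> C i \<Longrightarrow> x \<noteq> y \<Longrightarrow> d \<le> \<bar>x - y\<bar>"
      using finite_separated[OF C(1)[of i]] by metis
    have "norm (freq ((=) x) (p n i) - freq ((=) x) (q n i)) \<le> 1 / real (Suc n) * (2 / d)" for n
    proof -
      have "d * \<bar>freq ((=) x) (p n i) - freq ((=) x) (q n i)\<bar> \<le> 2 * mu1u (p n i) (q n i)"
        by (rule freq_diff_le_mu1u[OF p(1) q(1) p(2) q(2) d x])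
      also have "\<dots> \<le> 2 * (1 / real (Suc n))"
        using mu1u_le_mu1u_tuple[of "p n" i "q n"] pq[of n] by simp
      also have "\<dots> = d * (1 / real (Suc n) * (2 / d))" using d(1) by simp
      finally show ?thesis using d(1) by (simp only: mult_le_cancel_left_pos real_norm_def)
    qed
    moreover have "(\<lambda>n. 1 / real (Suc n) * (2 / d)) \<longlonglongrightarrow> 0"
      by (rule tendsto_mult_left_zero[OF inverse_Suc_tendsto])
    ultimately have "(\<lambda>n. freq ((=) x) (p n i) - freq ((=) x) (q n i)) \<longlonglongrightarrow> 0"
      by (rule Lim_null_comparison[OF always_eventually, OF allI])
    then have "(\<lambda>n. freq ((=) x) (p (r n) i) - freq ((=) x) (q (r n) i)) \<longlonglongrightarrow> 0"
      using LIMSEQ_subseq_LIMSEQ[OF _ r(1)] by (fastforce simp: o_def)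
    from tendsto_diff[OF \<beta>p[OF x] this] show ?thesis by simp
  qed
  \<comment> \<open>Consecutive terms of the subsequence may be far apart in the original one, so
    strict growth is first extended beyond successors.\<close>
  have mono: "length (p (r n) i) < length (p (r (Suc n)) i)" "length (q (r n) i) < length (q (r (Suc n)) i)" for n i
    using lift_Suc_mono_less[of "\<lambda>n. length (p n i)"] lift_Suc_mono_less[of "\<lambda>n. length (q n i)"] len
      strict_monoD[OF r(1), of n "Suc n"] by auto
  have "(\<lambda>n. \<bar>F (p (r n)) - F (q (r n))\<bar>) \<longlonglongrightarrow> 0"
    by (rule ct_continuous_clusters_at[OF ct C, where \<beta> = \<beta>])
      (auto intro!: clusters_atI p q mono \<beta>p \<beta>q dest: p(2)[THEN subsetD] q(2)[THEN subsetD])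
  then have "\<forall>\<^sub>F n in sequentially. \<bar>F (p (r n)) - F (q (r n))\<bar> < \<epsilon>"
    using \<epsilon> by (rule order_tendstoD)
  then show False using pq by (auto simp: eventually_sequentially)
qed

text \<open>Condition (1) is the preceding lemma. A failure of condition (2) at tolerances
  \<open>1 / (n + 1)\<close> yields sequences whose frequencies converge to the given
  \<open>\<alpha>\<close> without passing to a subsequence.\<close>

lemma ct_continuous_imp_up_continuous:
  fixes F :: "('m::finite \<Rightarrow> real list) \<Rightarrow> real"
  assumes ct: "\<And>k c \<alpha>. unit_parameters k c \<alpha> \<Longrightarrow> \<forall>i. inj_on (c i) {1..k i} \<Longrightarrow> ct_continuous F k c \<alpha>"
    and par: "unit_parameters k c \<alpha>"
  shows "up_continuous F k c \<alpha>"
proof -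
  define C where "C i = c i ` {1..k i}" for i
  have C: "finite (C i)" "C i \<noteq> {}" "C i \<subseteq> {0..1}" for i
  proof -
    have "k i \<ge> 1" "\<And>j. j \<in> {1..k i} \<Longrightarrow> c i j \<in> {0..1}"
      using par unfolding unit_parameters_def by blast+
    then show "finite (C i)" "C i \<noteq> {}" "C i \<subseteq> {0..1}" unfolding C_def by auto
  qed
  have AUC: "asymptotically_uniformly_continuous_on {p. \<forall>i. p i \<in> near_seqs (k i) (c i) (\<alpha> i) \<delta>} F" for \<delta>
    by (rule asymptotically_uniformly_continuous_finite_range[OF ct C]) (auto simp: near_seqs_def C_def)
  have "\<exists>\<delta>>0. \<exists>n\<^sub>0. \<forall>p\<in>unit_tuples. \<forall>q\<in>unit_tuples.
      (\<forall>i. length (p i) = length (q i) \<and> length (p i) > n\<^sub>0 \<and>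
        muinfo (p i) (q i) < \<delta> \<and> p i \<in> near_seqs (k i) (c i) (\<alpha> i) \<delta>) \<longrightarrow>
      \<bar>F p - F q\<bar> < \<epsilon>" if \<epsilon>: "\<epsilon> > 0" for \<epsilon>
  proof (rule ccontr)
    let ?R = "\<lambda>\<delta> p q. p \<in> unit_tuples \<and> q \<in> unit_tuples \<and>
      (\<forall>i. length (p i) = length (q i) \<and> muinfo (p i) (q i) < \<delta> \<and>
        p i \<in> near_seqs (k i) (c i) (\<alpha> i) \<delta>) \<and> \<not> \<bar>F p - F q\<bar> < \<epsilon>"
    assume "\<not> ?thesis"
    then have "\<exists>p q. ?R \<delta> p q \<and> (\<forall>i. N < length (p i) \<and> N < length (q i))" if "\<delta> > 0" for \<delta> N
      using that by metis
    then obtain p q where pq: "\<And>n. ?R (1 / real (Suc n)) (p n) (q n)"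
      and len: "\<And>n i. length (p n i) < length (p (Suc n) i)" "\<And>n i. length (q n i) < length (q (Suc n) i)"
      using growing_sequences[of ?R] by blast
    \<comment> \<open>If \<open>c i\<close> is not injective, the choice of the preimage is irrelevant: the frequency of \<open>c i j\<close>
      converges to \<open>\<alpha> i j\<close> for every \<open>j\<close>.\<close>
    define \<beta> where "\<beta> i x = \<alpha> i (inv_into {1..k i} (c i) x)" for i x
    have near: "p n i \<in> near_seqs (k i) (c i) (\<alpha> i) (1 / real (Suc n))" for n i using pq by blast
    have unit: "p n i \<in> unit_seqs" "q n i \<in> unit_seqs" for n i using pq[of n] by (auto simp: unit_tuples_def)
    have range: "set (p n i) \<subseteq> C i" for n i using near[of n i] by (simp add: near_seqs_iff C_def)
    have lim: "(\<lambda>n. freq ((=) x) (p n i)) \<longlonglongrightarrow> \<beta> i x" if "x \<in> C i" for i x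
    proof -
      have j: "inv_into {1..k i} (c i) x \<in> {1..k i}" "c i (inv_into {1..k i} (c i) x) = x"
        using that unfolding C_def by (rule inv_into_into, rule f_inv_into_f)
      then have "\<bar>freq ((=) x) (p n i) - \<beta> i x\<bar> \<le> 1 / real (Suc n)" for n
        using near[of n i] unfolding near_seqs_iff \<beta>_def by metis
      then have "\<forall>\<^sub>F n in sequentially. norm (freq ((=) x) (p n i) - \<beta> i x) \<le> 1 / real (Suc n)"
        by simp
      then have "(\<lambda>n. freq ((=) x) (p n i) - \<beta> i x) \<longlonglongrightarrow> 0"
        by (rule Lim_null_comparison) (rule inverse_Suc_tendsto)
      then show ?thesis by (simp add: LIM_zero_iff)
    qed
    have close: "list_all2 (\<lambda>x y. \<bar>x - y\<bar> \<le> 1 / real (Suc n)) (p n i) (q n i)" for n i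
      using pq[of n] by (intro muinfo_less_imp) auto
    have "clusters_at (C i) (\<beta> i) (\<lambda>n. p n i)" for i
      by (intro clusters_atI unit len range lim)
    \<comment> \<open>The sequence \<open>p\<close> serves as the rounding of
      \<open>q\<close>.\<close>
    moreover have "clusters_at (C i) (\<beta> i) (\<lambda>n. q n i)" for i
      unfolding clusters_at_def
      by (intro conjI exI[of _ "\<lambda>n. p n i"] exI[of _ "\<lambda>n. 1 / real (Suc n)"] allI ballI
          unit len range lim close inverse_Suc_tendsto)
    ultimately have "(\<lambda>n. \<bar>F (p n) - F (q n)\<bar>) \<longlonglongrightarrow> 0"
      by (intro ct_continuous_clusters_at[OF ct C])
    then have "\<forall>\<^sub>F n in sequentially. \<bar>F (p n) - F (q n)\<bar> < \<epsilon>"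
      using \<epsilon> by (rule order_tendstoD)
    then show False using pq by (auto simp: eventually_sequentially)
  qed
  \<comment> \<open>Since \<open>AUC\<close> holds for every \<open>\<delta>\<close>, the value 1
    serves as \<open>\<delta>\<^sub>0\<close>.\<close>
  then show ?thesis unfolding up_continuous_def using AUC zero_less_one by blast
qed

section \<open>From up-continuity to ct-continuity\<close>

text \<open>Open intervals of radius \<open>r\<close> around points at least \<open>2 * r\<close>
  apart are disjoint, so the definition applies to them; \<open>h\<close> sends each interval to its
  centre.\<close>

lemma convergence_testing_round:
  assumes ct: "convergence_testing k c \<alpha> p" and inj: "inj_on c {1..k}" and c: "c ` {1..k} \<subseteq> {0..1}"
    and sep: "\<And>x y. x \<in> c ` {1..k} \<Longrightarrow> y \<in> c ` {1..k} \<Longrightarrow> x \<noteq> y \<Longrightarrow> 2 * r \<le> \<bar>x - y\<bar>" and r: "r > 0"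
  obtains h where
    "\<forall>\<^sub>F n in sequentially. set (map h (p n)) \<subseteq> c ` {1..k} \<and> list_all2 (\<lambda>x y. \<bar>x - y\<bar> \<le> r) (map h (p n)) (p n)"
    "\<And>j. j \<in> {1..k} \<Longrightarrow> (\<lambda>n. freq ((=) (c j)) (map h (p n))) \<longlonglongrightarrow> \<alpha> j"
proof -
  define I where "I j = {0..1} \<inter> {c j - r<..<c j + r}" for j
  have c_in: "c j \<in> I j" if "j \<in> {1..k}" for j
    using subsetD[OF c imageI[OF that]] r by (simp add: I_def)
  have uniq: "j = l" if "j \<in> {1..k}" "l \<in> {1..k}" "x \<in> I j" "x \<in> I l" for j l x
  proof (rule ccontr)
    assume "j \<noteq> l"
    then have "c j \<noteq> c l" using inj that by (auto dest: inj_onD)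
    then have "2 * r \<le> \<bar>c j - c l\<bar>" using sep that by blast
    then show False using that by (auto simp: I_def)
  qed
  have "disjoint_family_on I {1..k}" unfolding disjoint_family_on_def using uniq by blast
  moreover have "is_interval (I j)" "openin (top_of_set {0..1}) (I j)" for j
    unfolding I_def by (intro is_interval_Int is_interval_cc is_interval_oo openin_open_Int open_greaterThanLessThan)+
  ultimately have "\<exists>N. \<forall>n\<ge>N. set (p n) \<subseteq> (\<Union>j\<in>{1..k}. I j)"
    and lim: "\<And>j. j \<in> {1..k} \<Longrightarrow>
      (\<lambda>n. real (card {i. i < length (p n) \<and> p n ! i \<in> I j}) / real (length (p n))) \<longlonglongrightarrow> \<alpha> j"
    using ct c_in unfolding convergence_testing_def by blast+
  then have ev: "\<forall>\<^sub>F n in sequentially. set (p n) \<subseteq> (\<Union>j\<in>{1..k}. I j)"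
    by (simp add: eventually_sequentially)
  \<comment> \<open>Outside all intervals the value of \<open>h\<close> is arbitrary; by
    \<open>ev\<close> such entries occur for only finitely many \<open>n\<close>.\<close>
  define h where "h x = c (SOME j. j \<in> {1..k} \<and> x \<in> I j)" for x
  have h: "h x = c j" if "j \<in> {1..k}" "x \<in> I j" for x j
  proof -
    have "(SOME j. j \<in> {1..k} \<and> x \<in> I j) = j" using that uniq by (intro some_equality) auto
    then show ?thesis by (simp add: h_def)
  qed
  show thesis
  proof
    show "\<forall>\<^sub>F n in sequentially. set (map h (p n)) \<subseteq> c ` {1..k} \<and>
        list_all2 (\<lambda>x y. \<bar>x - y\<bar> \<le> r) (map h (p n)) (p n)"
      using ev
    proof eventually_elim
      case (elim n)
      have "h x \<in> c ` {1..k} \<and> \<bar>h x - x\<bar> \<le> r" if x: "x \<in> set (p n)" for x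
      proof -
        obtain j where "j \<in> {1..k}" "x \<in> I j" using elim x by blast
        then show ?thesis using h[of j x] by (auto simp: I_def)
      qed
      then show ?case by (auto simp: list_all2_map1 intro!: list.rel_refl_strong)
    qed
    fix j assume j: "j \<in> {1..k}"
    \<comment> \<open>By uniqueness of the interval and injectivity of \<open>c\<close>, an entry is
      rounded to \<open>c j\<close> exactly if it lies in \<open>I j\<close>.\<close>
    from ev have "\<forall>\<^sub>F n in sequentially.
      real (card {i. i < length (p n) \<and> p n ! i \<in> I j}) / real (length (p n)) = freq ((=) (c j)) (map h (p n))"
    proof eventually_elim
      case (elim n)
      have "p n ! i \<in> I j \<longleftrightarrow> c j = map h (p n) ! i" if i: "i < length (p n)" for i
      proof -
        obtain l where l: "l \<in> {1..k}" "p n ! i \<in> I l" using elim nth_mem[OF i] by blast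
        then have "map h (p n) ! i = c l" using h i by simp
        then show ?thesis using l j uniq[of j l] inj_onD[OF inj, of j l] by auto
      qed
      then have "{i. i < length (p n) \<and> p n ! i \<in> I j} = {i. i < length (p n) \<and> c j = map h (p n) ! i}"
        by blast
      then show ?case by (simp only: freq_def length_filter_conv_card length_map)
    qed
    then show "(\<lambda>n. freq ((=) (c j)) (map h (p n))) \<longlonglongrightarrow> \<alpha> j"
      by (rule Lim_transform_eventually[OF lim[OF j]])
  qed
qed

text \<open>Rounded entries are eventually exact parameter points, so \<open>\<delta>\<close> may be
  arbitrarily small while the radius \<open>r\<close> stays fixed. Since there are finitely many
  coordinates, the eventual properties hold for all of them at once.\<close>

lemma convergence_testing_tuple_round:
  fixes k :: "'m::finite \<Rightarrow> nat"
  assumes p: "convergence_testing_tuple k c \<alpha> p" and inj: "\<And>i. inj_on (c i) {1..k i}"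
    and c: "\<And>i. c i ` {1..k i} \<subseteq> {0..1}"
    and sep: "\<And>i x y. x \<in> c i ` {1..k i} \<Longrightarrow> y \<in> c i ` {1..k i} \<Longrightarrow> x \<noteq> y \<Longrightarrow> 2 * r \<le> \<bar>x - y\<bar>" and r: "r > 0"
  shows "\<exists>p'. (\<forall>n i. length (p' n i) = length (p n i)) \<and>
    (\<forall>\<delta>>0. \<forall>\<^sub>F n in sequentially. \<forall>i. p' n i \<in> near_seqs (k i) (c i) (\<alpha> i) \<delta>) \<and>
    (\<forall>\<^sub>F n in sequentially. \<forall>i. muinfo (p' n i) (p n i) \<le> r) \<and>
    (\<forall>i. \<forall>j\<in>{1..k i}. (\<lambda>n. freq ((=) (c i j)) (p' n i)) \<longlonglongrightarrow> \<alpha> i j)"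
proof -
  have ct: "convergence_testing (k i) (c i) (\<alpha> i) (\<lambda>n. p n i)" for i
    using p by (simp add: convergence_testing_tuple_def)
  have ne: "p n i \<noteq> []" for n i using ct[of i] by (auto simp: convergence_testing_def unit_seqs_def)
  have "\<exists>h. (\<forall>\<^sub>F n in sequentially. set (map h (p n i)) \<subseteq> c i ` {1..k i} \<and>
      list_all2 (\<lambda>x y. \<bar>x - y\<bar> \<le> r) (map h (p n i)) (p n i)) \<and>
    (\<forall>j\<in>{1..k i}. (\<lambda>n. freq ((=) (c i j)) (map h (p n i))) \<longlonglongrightarrow> \<alpha> i j)" for i
    by (rule convergence_testing_round[OF ct[of i] inj[of i] c[of i] sep r]) blast+
  from choice[OF allI, OF this] obtain h where
    h_lim: "\<forall>i. (\<forall>\<^sub>F n in sequentially. set (map (h i) (p n i)) \<subseteq> c i ` {1..k i} \<and>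
      list_all2 (\<lambda>x y. \<bar>x - y\<bar> \<le> r) (map (h i) (p n i)) (p n i)) \<and>
    (\<forall>j\<in>{1..k i}. (\<lambda>n. freq ((=) (c i j)) (map (h i) (p n i))) \<longlonglongrightarrow> \<alpha> i j)"
    by (rule exE)
  have h: "\<forall>\<^sub>F n in sequentially. set (map (h i) (p n i)) \<subseteq> c i ` {1..k i} \<and>
      list_all2 (\<lambda>x y. \<bar>x - y\<bar> \<le> r) (map (h i) (p n i)) (p n i)" for i
    using h_lim by (rule allE) (erule conjunct1)
  have lim: "(\<lambda>n. freq ((=) (c i j)) (map (h i) (p n i))) \<longlonglongrightarrow> \<alpha> i j" if "j \<in> {1..k i}" for i j
    using bspec[OF conjunct2[OF spec[OF h_lim]] that] .
  show ?thesis
  proof (intro exI[of _ "\<lambda>n i. map (h i) (p n i)"] conjI)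
    show "\<forall>\<^sub>F n in sequentially. \<forall>i. muinfo (map (h i) (p n i)) (p n i) \<le> r"
    proof (rule eventually_all_finite)
      fix i
      show "\<forall>\<^sub>F n in sequentially. muinfo (map (h i) (p n i)) (p n i) \<le> r"
        using h[of i] by eventually_elim (intro muinfo_le, simp add: ne, blast)
    qed
    show "\<forall>\<delta>>0. \<forall>\<^sub>F n in sequentially. \<forall>i. map (h i) (p n i) \<in> near_seqs (k i) (c i) (\<alpha> i) \<delta>"
    proof (intro allI impI eventually_all_finite)
      fix \<delta> :: real and i assume \<delta>: "\<delta> > 0"
      have "\<forall>\<^sub>F n in sequentially. \<forall>j\<in>{1..k i}. dist (freq ((=) (c i j)) (map (h i) (p n i))) (\<alpha> i j) < \<delta>"
        by (intro eventually_ball_finite ballI tendstoD lim \<delta>) auto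
      with h[of i] show "\<forall>\<^sub>F n in sequentially. map (h i) (p n i) \<in> near_seqs (k i) (c i) (\<alpha> i) \<delta>"
      proof eventually_elim
        case (elim n)
        then have "set (map (h i) (p n i)) \<subseteq> {0..1}" using c[of i] by blast
        then have "map (h i) (p n i) \<in> unit_seqs" using ne by (auto simp: unit_seqs_def)
        then show ?case using elim by (auto simp: near_seqs_iff dist_real_def less_imp_le)
      qed
    qed
  qed (use lim in auto)
qed

text \<open>Turns lower bounds on the index into the lower bounds on lengths that up-continuity
  requires.\<close>

lemma convergence_testing_length:
  assumes "convergence_testing k c \<alpha> p"
  shows "n \<le> length (p n)"
proof (induction n)
  case (Suc n)
  moreover have "length (p n) < length (p (Suc n))" using assms by (auto simp: convergence_testing_def)
  ultimately show ?case by simp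
qed simp

text \<open>Three comparisons within \<open>\<epsilon> / 3\<close>: condition (2) between each tuple
  and its rounding, condition (1) between the two roundings. The rounding radius depends on
  \<open>\<epsilon>\<close>, so the rounded sequences are chosen after it.\<close>

lemma up_continuous_imp_ct_continuous:
  fixes F :: "('m::finite \<Rightarrow> real list) \<Rightarrow> real"
  assumes up: "up_continuous F k c \<alpha>" and par: "unit_parameters k c \<alpha>"
    and inj: "\<And>i. inj_on (c i) {1..k i}"
  shows "ct_continuous F k c \<alpha>"
  unfolding ct_continuous_def
proof (intro allI impI)
  fix p q assume pq: "convergence_testing_tuple k c \<alpha> p \<and> convergence_testing_tuple k c \<alpha> q"
  define C where "C i = c i ` {1..k i}" for i
  have fin: "finite (C i)" for i by (simp add: C_def)
  have c: "c i ` {1..k i} \<subseteq> {0..1}" for i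
    using par unfolding unit_parameters_def by blast
  have unit: "p n \<in> unit_tuples" "q n \<in> unit_tuples" for n
    using pq by (auto simp: convergence_testing_tuple_def convergence_testing_def unit_tuples_def)
  have len: "n \<le> length (p n i)" "n \<le> length (q n i)" for n i
    using pq convergence_testing_length[of "k i" "c i" "\<alpha> i" "\<lambda>n. p n i"]
      convergence_testing_length[of "k i" "c i" "\<alpha> i" "\<lambda>n. q n i"]
    by (auto simp: convergence_testing_tuple_def)
  have "\<exists>d>0. \<forall>x\<in>C i. \<forall>y\<in>C i. x \<noteq> y \<longrightarrow> d \<le> \<bar>x - y\<bar>" for i
    using finite_separated[OF fin[of i]] by metis
  then obtain d where d: "\<And>i. d i > 0" "\<And>i x y. x \<in> C i \<Longrightarrow> y \<in> C i \<Longrightarrow> x \<noteq> y \<Longrightarrow> d i \<le> \<bar>x - y\<bar>"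
    by metis
  show "(\<lambda>n. \<bar>F (p n) - F (q n)\<bar>) \<longlonglongrightarrow> 0"
  proof (rule LIMSEQ_I)
    fix \<epsilon> :: real assume \<epsilon>: "\<epsilon> > 0"
    then have \<epsilon>3: "\<epsilon> / 3 > 0" by simp
    obtain \<delta>0 where \<delta>0: "\<delta>0 > 0" and auc: "\<forall>\<delta>. 0 < \<delta> \<and> \<delta> < \<delta>0 \<longrightarrow>
        asymptotically_uniformly_continuous_on {p. \<forall>i. p i \<in> near_seqs (k i) (c i) (\<alpha> i) \<delta>} F"
      using up unfolding up_continuous_def by (elim conjE exE) (rule that)
    \<comment> \<open>Condition (1) is given only strictly below \<open>\<delta>0\<close>.\<close>
    define \<delta>1 where "\<delta>1 = \<delta>0 / 2"
    have \<delta>1: "\<delta>1 > 0" "\<delta>1 < \<delta>0" using \<delta>0 by (simp_all add: \<delta>1_def)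
    let ?X = "{p. \<forall>i. p i \<in> near_seqs (k i) (c i) (\<alpha> i) \<delta>1}"
    have "asymptotically_uniformly_continuous_on ?X F" using auc \<delta>1 by blast
    from this[unfolded asymptotically_uniformly_continuous_on_def, rule_format, OF \<epsilon>3]
    obtain n1 \<delta>2 where \<delta>2: "\<delta>2 > 0"
      and F1: "\<forall>p\<in>?X. \<forall>q\<in>?X. (\<forall>i. length (p i) \<ge> n1 \<and> length (q i) \<ge> n1) \<and>
        mu1u_tuple p q < \<delta>2 \<longrightarrow> \<bar>F p - F q\<bar> < \<epsilon> / 3"
      by (elim conjE exE) (rule that)
    from conjunct2[OF up[unfolded up_continuous_def], rule_format, OF \<epsilon>3]
    obtain \<delta>3 n3 where \<delta>3: "\<delta>3 > 0"
      and F2: "\<forall>p\<in>unit_tuples. \<forall>q\<in>unit_tuples.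
        (\<forall>i. length (p i) = length (q i) \<and> length (p i) > n3 \<and>
             muinfo (p i) (q i) < \<delta>3 \<and> p i \<in> near_seqs (k i) (c i) (\<alpha> i) \<delta>3) \<longrightarrow>
        \<bar>F p - F q\<bar> < \<epsilon> / 3"
      by (elim conjE exE) (rule that)
    \<comment> \<open>The first bound makes the weak inequality for rounding strict below
      \<open>\<delta>3\<close>; the second makes the rounding intervals disjoint in every
      coordinate.\<close>
    define r where "r = min (\<delta>3 / 2) (Min (range d) / 2)"
    have "Min (range d) > 0" using d(1) by (subst Min_gr_iff) auto
    then have r: "r > 0" "r < \<delta>3" using \<delta>3 by (auto simp: r_def)
    have "2 * r \<le> d i" for i
    proof -
      have "Min (range d) \<le> d i" by simp
      moreover have "r \<le> Min (range d) / 2" unfolding r_def by (rule min.cobounded2)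
      ultimately show ?thesis by linarith
    qed
    then have sep: "2 * r \<le> \<bar>x - y\<bar>" if "x \<in> c i ` {1..k i}" "y \<in> c i ` {1..k i}" "x \<noteq> y" for i x y
      using d(2)[of x i y] that unfolding C_def by (meson order_trans)
    have "\<exists>p'. (\<forall>n i. length (p' n i) = length (p n i)) \<and>
        (\<forall>\<delta>>0. \<forall>\<^sub>F n in sequentially. \<forall>i. p' n i \<in> near_seqs (k i) (c i) (\<alpha> i) \<delta>) \<and>
        (\<forall>\<^sub>F n in sequentially. \<forall>i. muinfo (p' n i) (p n i) \<le> r) \<and>
        (\<forall>i. \<forall>j\<in>{1..k i}. (\<lambda>n. freq ((=) (c i j)) (p' n i)) \<longlonglongrightarrow> \<alpha> i j)"
      (is "\<exists>p'. ?round p'")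
      by (rule convergence_testing_tuple_round[OF conjunct1[OF pq] inj c sep r(1)])
    then obtain p' where "?round p'" by (rule exE)
    note p' = conjunct1[OF this, rule_format] conjunct1[OF conjunct2[OF this], rule_format]
      conjunct1[OF conjunct2[OF conjunct2[OF this]]]
      conjunct2[OF conjunct2[OF conjunct2[OF this]], rule_format]
    have "\<exists>q'. (\<forall>n i. length (q' n i) = length (q n i)) \<and>
        (\<forall>\<delta>>0. \<forall>\<^sub>F n in sequentially. \<forall>i. q' n i \<in> near_seqs (k i) (c i) (\<alpha> i) \<delta>) \<and>
        (\<forall>\<^sub>F n in sequentially. \<forall>i. muinfo (q' n i) (q n i) \<le> r) \<and>
        (\<forall>i. \<forall>j\<in>{1..k i}. (\<lambda>n. freq ((=) (c i j)) (q' n i)) \<longlonglongrightarrow> \<alpha> i j)"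
      (is "\<exists>q'. ?round q'")
      by (rule convergence_testing_tuple_round[OF conjunct2[OF pq] inj c sep r(1)])
    then obtain q' where "?round q'" by (rule exE)
    note q' = conjunct1[OF this, rule_format] conjunct1[OF conjunct2[OF this], rule_format]
      conjunct1[OF conjunct2[OF conjunct2[OF this]]]
      conjunct2[OF conjunct2[OF conjunct2[OF this]], rule_format]
    \<comment> \<open>This is the bound of \<open>mu1u_le_freq_diff\<close>; it vanishes because
      both roundings have the limit frequencies \<open>\<alpha>\<close>.\<close>
    have "\<forall>\<^sub>F n in sequentially. \<forall>i. real (card (C i)) *
        (\<Sum>x\<in>C i. \<bar>freq ((=) x) (p' n i) - freq ((=) x) (q' n i)\<bar>) < \<delta>2"
    proof (rule eventually_all_finite)
      fix i
      have "(\<lambda>n. \<bar>freq ((=) x) (p' n i) - freq ((=) x) (q' n i)\<bar>) \<longlonglongrightarrow> 0" if x: "x \<in> C i" for x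
      proof -
        obtain j where j: "j \<in> {1..k i}" "x = c i j" using x by (auto simp: C_def)
        show ?thesis using tendsto_rabs[OF tendsto_diff[OF p'(4)[OF j(1)] q'(4)[OF j(1)]]] j(2) by simp
      qed
      then have "(\<lambda>n. real (card (C i)) *
          (\<Sum>x\<in>C i. \<bar>freq ((=) x) (p' n i) - freq ((=) x) (q' n i)\<bar>)) \<longlonglongrightarrow> 0"
        by (intro tendsto_mult_right_zero tendsto_null_sum)
      then show "\<forall>\<^sub>F n in sequentially. real (card (C i)) *
          (\<Sum>x\<in>C i. \<bar>freq ((=) x) (p' n i) - freq ((=) x) (q' n i)\<bar>) < \<delta>2"
        using \<delta>2 by (rule order_tendstoD)
    qed
    with p'(2)[OF \<delta>1(1)] p'(2)[OF \<delta>3] p'(3) q'(2)[OF \<delta>1(1)] q'(2)[OF \<delta>3] q'(3)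
      eventually_ge_at_top[of n1] eventually_gt_at_top[of n3]
    have "\<forall>\<^sub>F n in sequentially. \<bar>F (p n) - F (q n)\<bar> < \<epsilon>"
    proof eventually_elim
      case (elim n)
      have unit': "p' n \<in> unit_tuples" "q' n \<in> unit_tuples"
        using elim by (auto simp: unit_tuples_def near_seqs_def)
      have "mu1u (p' n i) (q' n i) < \<delta>2" for i
      proof -
        have "p' n i \<in> unit_seqs" "set (p' n i) \<subseteq> C i" "q' n i \<in> unit_seqs" "set (q' n i) \<subseteq> C i"
          using elim(1)[rule_format, of i] elim(4)[rule_format, of i] by (simp_all add: near_seqs_iff C_def)
        from mu1u_le_freq_diff[OF this(1,3,2,4) fin] elim(9)[rule_format, of i] show ?thesis
          by (rule le_less_trans)
      qed
      then have "mu1u_tuple (p' n) (q' n) < \<delta>2"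
        unfolding mu1u_tuple_def by (subst Max_less_iff) auto
      moreover have "n1 \<le> length (p' n i) \<and> n1 \<le> length (q' n i)" for i
        using elim(7) len[of n i] by (simp add: p'(1) q'(1))
      ultimately have "\<bar>F (p' n) - F (q' n)\<bar> < \<epsilon> / 3"
        using F1 elim(1,4) by blast
      \<comment> \<open>The rounded tuple comes first, since condition (2) restricts the entries of
        its first tuple to the parameter points.\<close>
      moreover have "\<bar>F (p' n) - F (p n)\<bar> < \<epsilon> / 3"
      proof (intro F2[rule_format] unit unit' conjI)
        fix i
        show "muinfo (p' n i) (p n i) < \<delta>3" using elim(3) r(2) by (meson le_less_trans)
        show "n3 < length (p' n i)" using elim(8) len(1)[of n i] by (simp add: p'(1))
      qed (use elim(2) p'(1) in auto)
      moreover have "\<bar>F (q' n) - F (q n)\<bar> < \<epsilon> / 3"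
      proof (intro F2[rule_format] unit unit' conjI)
        fix i
        show "muinfo (q' n i) (q n i) < \<delta>3" using elim(6) r(2) by (meson le_less_trans)
        show "n3 < length (q' n i)" using elim(8) len(2)[of n i] by (simp add: q'(1))
      qed (use elim(5) q'(1) in auto)
      ultimately show ?case by linarith
    qed
    then show "\<exists>N. \<forall>n\<ge>N. norm (\<bar>F (p n) - F (q n)\<bar> - 0) < \<epsilon>"
      by (simp add: eventually_sequentially)
  qed
qed

text \<open>Distinctness is asked for on the ct side, where repeated points admit no disjoint family
  of intervals. On the up side repetitions are allowed, and the forward implication handles them by
  working with the sets of parameter points.\<close>

theorem corollary4p11:
  fixes F :: "('m::finite \<Rightarrow> real list) \<Rightarrow> real"
  assumes "aggregation_function F"
  shows "(\<forall>k c \<alpha>. unit_parameters k c \<alpha> \<and> (\<forall>i. inj_on (c i) {1..k i}) \<longrightarrow> ct_continuous F k c \<alpha>)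
    \<longleftrightarrow> (\<forall>k c \<alpha>. unit_parameters k c \<alpha> \<longrightarrow> up_continuous F k c \<alpha>)"
  using ct_continuous_imp_up_continuous[of F] up_continuous_imp_ct_continuous[of F] by blast

end
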